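(* Let $G$ be a graph of order $n$. Then for any set $\{\lambda_1,\dots,\lambda_n\}$ of $n$ distinct nonzero real numbers there is a matrix $A\in\mathcal{S}(G)$ that has the Strong Spectral Property, has spectrum $\{\lambda_1,\dots,\lambda_n\}$, and has all diagonal entries nonzero.
   Context: For a graph $G$ with vertex set $\{1,\dots,n\}$, $\mathcal{S}(G)$ is the set of real symmetric $n\times n$ matrices $A=[a_{ij}]$ such that for $i\neq j$, $a_{ij}\neq 0$ if and only if $ij$ is an edge of $G$ (diagonal unrestricted). $A\circ X$ denotes the entrywise (Hadamard) product. A real symmetric $n\times n$ matrix $A$ has the Strong Spectral Property (SSP) if the only real symmetric matrix $X$ satisfying $A\circ X=0$, $I\circ X=0$ and $AX-XA=0$ is $X=0$. *)

theory Defs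
  imports "HOL-Analysis.Analysis"
begin

text \<open>A simple graph of order \<open>n = CARD('n)\<close> on the vertex set \<open>UNIV :: 'n set\<close>, given by its
  adjacency relation.\<close>

definition simple_graph :: "('n \<Rightarrow> 'n \<Rightarrow> bool) \<Rightarrow> bool" where
  "simple_graph E \<longleftrightarrow> symp E \<and> irreflp E"

definition symmetric_matrix :: "real ^ 'n ^ 'n \<Rightarrow> bool" where
  "symmetric_matrix A \<longleftrightarrow> transpose A = A"

definition graph_matrices :: "('n \<Rightarrow> 'n \<Rightarrow> bool) \<Rightarrow> (real ^ 'n ^ 'n) set" where
  "graph_matrices E =
     {A. symmetric_matrix A \<and> (\<forall>i j. i \<noteq> j \<longrightarrow> (A $ i $ j \<noteq> 0 \<longleftrightarrow> E i j))}"

definition hadamard :: "real ^ 'n ^ 'n \<Rightarrow> real ^ 'n ^ 'n \<Rightarrow> real ^ 'n ^ 'n" (infixl "\<circ>\<^sub>H" 70) where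
  "A \<circ>\<^sub>H B = (\<chi> i j. A $ i $ j * B $ i $ j)"

definition strong_spectral_property :: "real ^ 'n ^ 'n \<Rightarrow> bool" where
  "strong_spectral_property A \<longleftrightarrow>
     symmetric_matrix A \<and>
     (\<forall>X. symmetric_matrix X \<and> A \<circ>\<^sub>H X = 0 \<and> mat 1 \<circ>\<^sub>H X = 0 \<and> A ** X - X ** A = 0
          \<longrightarrow> X = 0)"

text \<open>The set of real eigenvalues. For a symmetric matrix these are all eigenvalues, and when
  there are \<open>CARD('n)\<close> of them each one is simple, so no multiplicities are lost.\<close>

definition spectrum :: "real ^ 'n ^ 'n \<Rightarrow> real set" where
  "spectrum A = {k. \<exists>v. v \<noteq> 0 \<and> A *v v = k *\<^sub>R v}"

end

theory Submission
  imports Defs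
begin

text \<open>
  Look for \<open>A = diag d + \<epsilon> B\<close>, with \<open>B\<close> the adjacency matrix of the graph, \<open>\<epsilon> > 0\<close> small, and
  \<open>d\<close> close to \<open>\<lambda>\<close>. Expanding \<open>det (A - \<lambda>\<^sub>k I)\<close> linearly along row \<open>k\<close> gives
  \<open>(d\<^sub>k - \<lambda>\<^sub>k) M\<^sub>k + \<epsilon> N\<^sub>k\<close>, where \<open>M\<^sub>k \<noteq> 0\<close> near \<open>(\<epsilon>, d) = (0, \<lambda>)\<close>, so every \<open>\<lambda>\<^sub>k\<close> is an
  eigenvalue of \<open>A\<close> as soon as \<open>d\<close> is a fixed point of \<open>d \<mapsto> (\<lambda>\<^sub>k - \<epsilon> N\<^sub>k / M\<^sub>k)\<^sub>k\<close>; Brouwer's theorem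
  provides one near \<open>\<lambda>\<close>. The Strong Spectral Property holds because the diagonal of \<open>A\<close> has
  well-separated entries: \<open>(d\<^sub>i - d\<^sub>j) x\<^sub>i\<^sub>j = \<epsilon> (X B - B X)\<^sub>i\<^sub>j\<close> cannot hold at an entry of \<open>X\<close> of
  maximal modulus unless \<open>X = 0\<close>.
\<close>

section \<open>Determinants and the number of eigenvalues\<close>

lemma continuous_on_det_entries:
  fixes A :: "'a::topological_space \<Rightarrow> real ^ 'n ^ 'n"
  assumes "\<And>i j. continuous_on S (\<lambda>x. A x $ i $ j)"
  shows "continuous_on S (\<lambda>x. det (A x))"
  unfolding det_def by (intro continuous_intros assms)

lemma spectrum_iff_det:
  fixes A :: "real ^ 'n ^ 'n"
  shows "k \<in> spectrum A \<longleftrightarrow> det (A - mat k) = 0"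
proof -
  have *: "(A - mat k) *v v = A *v v - k *\<^sub>R v" for v :: "real ^ 'n"
    by (simp add: matrix_vector_mult_diff_rdistrib flip: matrix_scaleR)
  have "det (A - mat k) = 0 \<longleftrightarrow> (\<exists>v. v \<noteq> 0 \<and> (A - mat k) *v v = 0)"
    using invertible_det_nz[of "A - mat k"] matrix_left_invertible_ker[of "A - mat k"]
      invertible_left_inverse[of "A - mat k"] by auto
  then show ?thesis
    by (simp add: spectrum_def *)
qed

lemma symmetric_eigenvectors_orthogonal:
  fixes A :: "real ^ 'n ^ 'n"
  assumes "symmetric_matrix A" "A *v v = a *\<^sub>R v" "A *v w = b *\<^sub>R w" "a \<noteq> b"
  shows "v \<bullet> w = 0"
proof -
  have "(A *v v) \<bullet> w = v \<bullet> (A *v w)"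
    using assms(1) dot_lmul_matrix[of v A w] unfolding symmetric_matrix_def
    by (metis transpose_matrix_vector)
  then show ?thesis
    using assms by simp
qed

text \<open>Eigenvectors for distinct eigenvalues are orthogonal, hence independent. So once
  \<open>CARD('n)\<close> eigenvalues have been produced, no others can exist.\<close>

lemma card_eigenvalues_le:
  fixes A :: "real ^ 'n ^ 'n"
  assumes A: "symmetric_matrix A" and T: "T \<subseteq> spectrum A"
  shows "card T \<le> CARD('n)"
proof -
  obtain v where v: "\<And>k. k \<in> T \<Longrightarrow> v k \<noteq> 0 \<and> A *v v k = k *\<^sub>R v k"
    using T unfolding spectrum_def subset_iff mem_Collect_eq by metis
  have orth: "v a \<bullet> v b = 0" if "a \<in> T" "b \<in> T" "a \<noteq> b" for a b
    using symmetric_eigenvectors_orthogonal[OF A] v that by blast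
  have "inj_on v T"
    using orth v by (metis inj_onI inner_eq_zero_iff)
  moreover have "independent (v ` T)"
  proof (rule pairwise_orthogonal_independent)
    show "pairwise orthogonal (v ` T)"
      using orth by (auto simp: pairwise_def orthogonal_def)
    show "0 \<notin> v ` T"
      using v by fastforce
  qed
  then have "card (v ` T) \<le> DIM(real ^ 'n)"
    using independent_bound by blast
  ultimately show ?thesis
    by (simp add: card_image)
qed

lemma spectrum_eqI:
  fixes A :: "real ^ 'n ^ 'n"
  assumes "symmetric_matrix A" "\<Lambda> \<subseteq> spectrum A" "card \<Lambda> = CARD('n)"
  shows "spectrum A = \<Lambda>"
proof (rule ccontr)
  assume "spectrum A \<noteq> \<Lambda>"
  with assms(2) obtain k where k: "k \<in> spectrum A" "k \<notin> \<Lambda>"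
    by blast
  \<comment> \<open>An infinite set has \<open>card\<close> 0, whereas \<open>CARD('n)\<close> is
    positive.\<close>
  have "finite \<Lambda>"
    using assms(3) card_ge_0_finite[of \<Lambda>] by simp
  then have "card (insert k \<Lambda>) = Suc CARD('n)"
    using k assms(3) by simp
  moreover have "card (insert k \<Lambda>) \<le> CARD('n)"
    using k assms by (intro card_eigenvalues_le[of A]) auto
  ultimately show False
    by simp
qed

section \<open>Commutation with a matrix whose diagonal entries are well separated\<close>

text \<open>At an entry of maximal modulus the commutator equation bounds \<open>g * \<bar>x\<^sub>i\<^sub>j\<bar>\<close> by
  \<open>2 n b * \<bar>x\<^sub>i\<^sub>j\<bar>\<close>.\<close>

lemma commuting_hollow_eq_0:
  fixes A X :: "real ^ 'n ^ 'n"
  assumes gap: "\<And>i j. i \<noteq> j \<Longrightarrow> g \<le> \<bar>A $ i $ i - A $ j $ j\<bar>"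
    and off: "\<And>i j. i \<noteq> j \<Longrightarrow> \<bar>A $ i $ j\<bar> \<le> b"
    and small: "2 * real CARD('n) * b < g" and "0 \<le> b"
    and hollow: "\<And>i. X $ i $ i = 0"
    and comm: "A ** X = X ** A"
  shows "X = 0"
proof -
  define m where "m = Max (range (\<lambda>(i, j). \<bar>X $ i $ j\<bar>))"
  have le_m: "\<bar>X $ i $ j\<bar> \<le> m" for i j
    unfolding m_def by (rule Max_ge) auto
  have "m \<in> range (\<lambda>(i, j). \<bar>X $ i $ j\<bar>)"
    unfolding m_def by (rule Max_in) auto
  then obtain i j where m: "m = \<bar>X $ i $ j\<bar>"
    by auto
  have "m = 0"
  proof (rule ccontr)
    assume "m \<noteq> 0"
    then have "i \<noteq> j" and "m > 0"
      using m hollow by auto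
    have "(\<Sum>l\<in>UNIV. A $ i $ l * X $ l $ j) = (\<Sum>l\<in>UNIV. X $ i $ l * A $ l $ j)"
      using comm by (simp add: matrix_matrix_mult_def vec_eq_iff)
    \<comment> \<open>Split off the term \<open>l = i\<close> on the left and \<open>l = j\<close>
      on the right: the remaining sums involve only off-diagonal entries of \<open>A\<close>, which
      \<open>b\<close> bounds.\<close>
    then have eq: "(A $ i $ i - A $ j $ j) * X $ i $ j =
        (\<Sum>l\<in>UNIV - {j}. X $ i $ l * A $ l $ j) - (\<Sum>l\<in>UNIV - {i}. A $ i $ l * X $ l $ j)"
      using sum.remove[of UNIV i "\<lambda>l. A $ i $ l * X $ l $ j"]
        sum.remove[of UNIV j "\<lambda>l. X $ i $ l * A $ l $ j"] by (simp add: left_diff_distrib mult.commute[of "X $ i $ j"])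
    have sum_le: "\<bar>sum f (UNIV - {k})\<bar> \<le> real CARD('n) * (b * m)"
      if f: "\<And>l. l \<noteq> k \<Longrightarrow> \<bar>f l\<bar> \<le> b * m" for f :: "'n \<Rightarrow> real" and k
    proof -
      have "\<bar>sum f (UNIV - {k})\<bar> \<le> (\<Sum>l\<in>UNIV - {k}. b * m)"
        by (rule order_trans[OF sum_abs]) (intro sum_mono, use f in auto)
      also have "\<dots> \<le> (\<Sum>l\<in>(UNIV :: 'n set). b * m)"
        using \<open>0 \<le> b\<close> \<open>m > 0\<close> by (intro sum_mono2) auto
      finally show ?thesis
        by simp
    qed
    have "g * m \<le> \<bar>A $ i $ i - A $ j $ j\<bar> * \<bar>X $ i $ j\<bar>"
      using gap[OF \<open>i \<noteq> j\<close>] m by (simp add: mult_right_mono)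
    also have "\<dots> = \<bar>(\<Sum>l\<in>UNIV - {j}. X $ i $ l * A $ l $ j)
        - (\<Sum>l\<in>UNIV - {i}. A $ i $ l * X $ l $ j)\<bar>"
      using eq by (simp flip: abs_mult)
    also have "\<dots> \<le> real CARD('n) * (b * m) + real CARD('n) * (b * m)"
    proof (rule order_trans[OF abs_triangle_ineq4], rule add_mono; rule sum_le)
      show "\<bar>X $ i $ l * A $ l $ j\<bar> \<le> b * m" if "l \<noteq> j" for l
        using mult_mono[OF off[OF that] le_m[of i l]] \<open>0 \<le> b\<close> by (simp add: abs_mult mult.commute)
      show "\<bar>A $ i $ l * X $ l $ j\<bar> \<le> b * m" if "l \<noteq> i" for l
        using mult_mono[OF off[of i l] le_m[of l j]] \<open>0 \<le> b\<close> that by (auto simp: abs_mult)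
    qed
    also have "\<dots> = (2 * real CARD('n) * b) * m"
      by simp
    finally show False
      using small \<open>m > 0\<close> by (simp add: mult_less_cancel_right)
  qed
  then show ?thesis
    using le_m by (simp add: vec_eq_iff)
qed

section \<open>Perturbed diagonal matrices with prescribed eigenvalues\<close>

definition perturbed_diagonal :: "real ^ 'n ^ 'n \<Rightarrow> real \<Rightarrow> real ^ 'n \<Rightarrow> real ^ 'n ^ 'n" where
  "perturbed_diagonal B e d = (\<chi> i j. if i = j then d $ i else e * B $ i $ j)"

definition replace_row :: "'n \<Rightarrow> real ^ 'n \<Rightarrow> real ^ 'n ^ 'n \<Rightarrow> real ^ 'n ^ 'n" where
  "replace_row k v A = (\<chi> i. if i = k then v else A $ i)"

text \<open>The determinant is linear in row \<open>k\<close>, and \<open>B $ k $ k = 0\<close>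
  keeps \<open>d $ k - t\<close> apart from the \<open>e\<close> part of that row. Both remaining
  determinants are free of \<open>d $ k\<close>, as row \<open>k\<close> has been
  overwritten.\<close>

lemma det_perturbed_diagonal_shift:
  fixes B :: "real ^ 'n ^ 'n" and d :: "real ^ 'n" and e t :: real
  assumes B: "B $ k $ k = 0"
  defines "C \<equiv> perturbed_diagonal B e d - mat t"
  shows "det C = (d $ k - t) * det (replace_row k (axis k 1) C) + e * det (replace_row k (B $ k) C)"
proof -
  have "C $ k = (d $ k - t) *s axis k 1 + e *s B $ k"
    using B by (auto simp: C_def perturbed_diagonal_def vec_eq_iff mat_def axis_def)
  then have "C = (\<chi> i. if i = k then (d $ k - t) *s axis k 1 + e *s B $ k else C $ i)"
    by (auto simp: vec_eq_iff)
  then have "det C = det (\<chi> i. if i = k then (d $ k - t) *s axis k 1 + e *s B $ k else C $ i)"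
    by simp
  also have "\<dots> = (d $ k - t) * det (replace_row k (axis k 1) C) + e * det (replace_row k (B $ k) C)"
    unfolding replace_row_def
    by (simp add: det_row_add[of k "\<lambda>_. (d $ k - t) *s axis k 1" "\<lambda>_. e *s B $ k"]
        det_row_mul[of k "d $ k - t" "\<lambda>_. axis k 1"] det_row_mul[of k e "\<lambda>_. B $ k"])
  finally show ?thesis .
qed

text \<open>At \<open>e = 0\<close> the matrix is diagonal, with entry 1 at \<open>k\<close> and the
  nonzero differences \<open>l $ i - l $ k\<close> elsewhere.\<close>

lemma det_replace_row_axis_diagonal_nz:
  fixes l :: "real ^ 'n"
  assumes "\<And>i. i \<noteq> k \<Longrightarrow> l $ i \<noteq> l $ k"
  shows "det (replace_row k (axis k 1) (perturbed_diagonal B 0 l - mat (l $ k))) \<noteq> 0"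
  by (subst det_diagonal)
    (use assms in \<open>auto simp: replace_row_def perturbed_diagonal_def mat_def axis_def\<close>)

lemma continuous_on_det_replace_row_perturbed_diagonal:
  "continuous_on S (\<lambda>p. det (replace_row k v (perturbed_diagonal B (fst p) (snd p) - mat t)))"
proof (rule continuous_on_det_entries)
  show "continuous_on S (\<lambda>p. replace_row k v (perturbed_diagonal B (fst p) (snd p) - mat t) $ i $ j)"
    for i j
    by (cases "i = k"; cases "i = j")
      (auto simp: replace_row_def perturbed_diagonal_def intro!: continuous_intros)
qed

lemma perturbed_diagonal_spectrum:
  fixes B :: "real ^ 'n ^ 'n" and l :: "real ^ 'n"
  assumes hollow: "\<And>i. B $ i $ i = 0" and inj: "\<And>i j. i \<noteq> j \<Longrightarrow> l $ i \<noteq> l $ j"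
    and "r > 0"
  obtains e0 where "e0 > 0"
    and "\<And>e. \<lbrakk>0 < e; e \<le> e0\<rbrakk> \<Longrightarrow>
           \<exists>d \<in> cball l r. \<forall>k. l $ k \<in> spectrum (perturbed_diagonal B e d)"
proof -
  define C where "C k p = perturbed_diagonal B (fst p) (snd p) - mat (l $ k)" for k p
  define M where "M k p = det (replace_row k (axis k 1) (C k p))" for k p
  define N where "N k p = det (replace_row k (B $ k) (C k p))" for k p
  define f where "f p = (\<chi> k. N k p / M k p)" for p
  have cont: "continuous_on S (M k)" "continuous_on S (N k)" for S k
    unfolding M_def N_def C_def
    by (rule continuous_on_det_replace_row_perturbed_diagonal)+
  have "open (\<Inter>k. {p. M k p \<noteq> 0})"
    by (intro open_INT ballI open_Collect_neq cont continuous_intros) auto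
  moreover have "(0, l) \<in> (\<Inter>k. {p. M k p \<noteq> 0})"
    using inj by (simp add: M_def C_def det_replace_row_axis_diagonal_nz)
  \<comment> \<open>A closed ball is compact, so the quotients \<open>N k / M k\<close> are bounded
    on it, by one \<open>K\<close> that serves every small \<open>e\<close>.\<close>
  ultimately obtain s where s: "s > 0" "cball (0, l) s \<subseteq> (\<Inter>k. {p. M k p \<noteq> 0})"
    unfolding open_contains_cball by meson
  have contf: "continuous_on (cball (0, l) s) f"
    unfolding f_def using s by (intro continuous_intros cont) auto
  then have "bounded (f ` cball (0, l) s)"
    by (intro compact_imp_bounded compact_continuous_image) auto
  then obtain K where K: "K > 0" "\<And>p. p \<in> cball (0, l) s \<Longrightarrow> norm (f p) \<le> K"
    unfolding bounded_pos by auto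
  define r' where "r' = min r (s / 2)"
  have r': "r' > 0" "r' \<le> r" "r' \<le> s / 2"
    using \<open>r > 0\<close> s by (auto simp: r'_def)
  show thesis
  \<comment> \<open>With \<open>r' \<le> s / 2\<close>, the bound \<open>s / 2\<close> on
    \<open>e\<close> keeps \<open>(e, d)\<close> in the ball of radius \<open>s\<close>; the bound
    \<open>r' / K\<close> makes \<open>h\<close> map \<open>cball l r'\<close> into itself.\<close>
  proof (rule that[of "min (s / 2) (r' / K)"])
    show "0 < min (s / 2) (r' / K)"
      using s r' K by simp
    fix e :: real assume e: "0 < e" "e \<le> min (s / 2) (r' / K)"
    have mem: "(e, d) \<in> cball (0, l) s" if "d \<in> cball l r'" for d
    proof -
      have "dist (0, l) (e, d) \<le> \<bar>e\<bar> + dist l d"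
        unfolding dist_Pair_Pair
        by (rule order_trans[OF sqrt_sum_squares_le_sum_abs]) simp
      then show ?thesis
        using that e r' by simp
    qed
    define h where "h d = l - e *\<^sub>R f (e, d)" for d
    have "\<exists>d \<in> cball l r'. h d = d"
    proof (rule brouwer[of "cball l r'" h])
      show "continuous_on (cball l r') h"
        unfolding h_def
        by (intro continuous_intros continuous_on_compose2[OF contf]) (use mem in auto)
      have "norm (e *\<^sub>R f (e, d)) \<le> r'" if "d \<in> cball l r'" for d
      proof -
        have "e * norm (f (e, d)) \<le> e * K"
          using K(2)[OF mem[OF that]] e by simp
        also have "\<dots> \<le> r'"
          using e K by (simp add: field_simps)
        finally show ?thesis
          using e by simp
      qed
      then show "h \<in> cball l r' \<rightarrow> cball l r'"
        by (auto simp: h_def dist_norm)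
    qed (use r' in auto)
    then obtain d where d: "d \<in> cball l r'" "h d = d"
      by blast
    have "l $ k \<in> spectrum (perturbed_diagonal B e d)" for k
    proof -
      have "M k (e, d) \<noteq> 0"
        using mem[OF d(1)] s by auto
      \<comment> \<open>Coordinate \<open>k\<close> of the fixed point equation; multiplied by
        \<open>M k (e, d)\<close>, it says that the expanded determinant vanishes.\<close>
      moreover have "d $ k - l $ k = - (e * (N k (e, d) / M k (e, d)))"
        by (subst d(2)[symmetric]) (simp add: h_def f_def)
      ultimately have "(d $ k - l $ k) * M k (e, d) + e * N k (e, d) = 0"
        by simp
      then show ?thesis
        using det_perturbed_diagonal_shift[of B k e d "l $ k"] hollow
        by (simp add: spectrum_iff_det M_def N_def C_def)
    qed
    then show "\<exists>d \<in> cball l r. \<forall>k. l $ k \<in> spectrum (perturbed_diagonal B e d)"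
      using d r' by (intro bexI[of _ d]) auto
  qed
qed

theorem theorem2p4:
  fixes E :: "'n::finite \<Rightarrow> 'n \<Rightarrow> bool"
    and \<Lambda> :: "real set"
  assumes "simple_graph E"
    and "card \<Lambda> = CARD('n)"
    and "0 \<notin> \<Lambda>"
  shows "\<exists>A \<in> graph_matrices E.
           strong_spectral_property A \<and> spectrum A = \<Lambda> \<and> (\<forall>i. A $ i $ i \<noteq> 0)"
proof -
  define B :: "real ^ 'n ^ 'n" where "B = (\<chi> i j. of_bool (E i j))"
  have hollow: "B $ i $ i = 0" and B_sym: "B $ i $ j = B $ j $ i" for i j
    using assms(1) by (auto simp: B_def simple_graph_def irreflp_def symp_def)
  have "finite \<Lambda>"
    using assms(2) card_ge_0_finite[of \<Lambda>] by simp
  then obtain f where f: "bij_betw f (UNIV :: 'n set) \<Lambda>"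
    using assms(2) finite_same_card_bij[of "UNIV :: 'n set" \<Lambda>] by auto
  define l :: "real ^ 'n" where "l = (\<chi> i. f i)"
  have inj: "l $ i \<noteq> l $ j" if "i \<noteq> j" for i j
    using f that by (auto simp: l_def bij_betw_def inj_def)
  have l_range: "range (($) l) = \<Lambda>"
    using f by (auto simp: l_def bij_betw_def)
  \<comment> \<open>The gaps between eigenvalues serve the Strong Spectral Property; the distance
    from 0 keeps the diagonal of \<open>A\<close> nonzero.\<close>
  obtain g where g: "g > 0" "\<And>i j. i \<noteq> j \<Longrightarrow> g \<le> \<bar>l $ i - l $ j\<bar>" "\<And>i. g \<le> \<bar>l $ i\<bar>"
  proof
    let ?G = "insert 1 ((\<lambda>(i, j). \<bar>l $ i - l $ j\<bar>) ` {(i, j). i \<noteq> j} \<union> range (\<lambda>i. \<bar>l $ i\<bar>))"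
    have fin: "finite ?G"
      by simp
    have "\<bar>l $ i\<bar> > 0" for i
      using l_range assms(3) by (metis rangeI zero_less_abs_iff)
    then show "0 < Min ?G"
      using inj fin by (subst Min_gr_iff) auto
    show "Min ?G \<le> \<bar>l $ i - l $ j\<bar>" if "i \<noteq> j" for i j
      using that by (intro Min_le[OF fin]) auto
    show "Min ?G \<le> \<bar>l $ i\<bar>" for i
      by (intro Min_le[OF fin]) auto
  qed
  obtain e0 where e0: "e0 > 0"
    "\<And>e. \<lbrakk>0 < e; e \<le> e0\<rbrakk> \<Longrightarrow>
       \<exists>d \<in> cball l (g / 4). \<forall>k. l $ k \<in> spectrum (perturbed_diagonal B e d)"
    using perturbed_diagonal_spectrum[OF hollow inj, of "g / 4"] g(1) by auto
  \<comment> \<open>Moving each \<open>l $ i\<close> by at most \<open>g / 4\<close> leaves diagonal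
    gaps of at least \<open>g / 2\<close>, and the bound on \<open>e\<close> gives
    \<open>2 * real CARD('n) * e \<le> g / 4\<close>, strictly below that.\<close>
  define e where "e = min e0 (g / (8 * real CARD('n)))"
  have e: "e > 0" "e \<le> e0" "e \<le> g / (8 * real CARD('n))"
    using e0 g(1) by (auto simp: e_def)
  then obtain d where d: "d \<in> cball l (g / 4)"
    and d_spec: "\<And>k. l $ k \<in> spectrum (perturbed_diagonal B e d)"
    using e0(2) by blast
  have close: "\<bar>l $ i - d $ i\<bar> \<le> g / 4" for i
    using d component_le_norm_cart[of "l - d" i] by (simp add: dist_norm)
  define A where "A = perturbed_diagonal B e d"
  have sym: "symmetric_matrix A"
    using B_sym by (auto simp: symmetric_matrix_def A_def perturbed_diagonal_def transpose_def vec_eq_iff)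
  have "A \<in> graph_matrices E"
    using sym e by (auto simp: graph_matrices_def A_def perturbed_diagonal_def B_def)
  moreover have "strong_spectral_property A"
    unfolding strong_spectral_property_def
  proof (intro conjI allI impI sym; elim conjE)
    fix X :: "real ^ 'n ^ 'n"
    assume "mat 1 \<circ>\<^sub>H X = 0" and comm: "A ** X - X ** A = 0"
    then have "(mat 1 \<circ>\<^sub>H X) $ i $ i = 0" for i
      by simp
    then have X_hollow: "X $ i $ i = 0" for i
      by (simp add: hadamard_def mat_def)
    have gap: "g / 2 \<le> \<bar>A $ i $ i - A $ j $ j\<bar>" if "i \<noteq> j" for i j
    proof -
      have "g / 2 \<le> \<bar>d $ i - d $ j\<bar>"
        using g(2)[OF that] close[of i] close[of j] by linarith
      then show ?thesis
        by (simp add: A_def perturbed_diagonal_def)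
    qed
    have off: "\<bar>A $ i $ j\<bar> \<le> e" if "i \<noteq> j" for i j
      using that e by (simp add: A_def perturbed_diagonal_def B_def)
    have "2 * real CARD('n) * e \<le> g / 4"
      using e(3) by (simp add: field_simps)
    then have small: "2 * real CARD('n) * e < g / 2"
      using g(1) by simp
    show "X = 0"
      using commuting_hollow_eq_0[OF gap off small _ X_hollow] e comm by simp
  qed
  moreover have "spectrum A = \<Lambda>"
    using sym d_spec l_range assms(2) unfolding A_def by (intro spectrum_eqI) auto
  moreover have "A $ i $ i \<noteq> 0" for i
    using g(1) g(3)[of i] close[of i] by (auto simp: A_def perturbed_diagonal_def)
  ultimately show ?thesis
    by blast
qed

end
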